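(* For each $j\in\{0,2,4\}$ let $f_j$ and $f_{j-1}$ be functions holomorphic in $\mathbf{D}_{t_j^{-1}(0)}$ (indices modulo $6$). To the covering $\{\mathbf{D}_0,\mathbf{D}_1,\mathbf{D}_\infty\}$ of $\mathbf{P}^1$ attach the 0-cochain $f=\{f_{\mathbf{D}_\alpha}\}_{\alpha=0,1,\infty}$, with $f_{\mathbf{D}_\alpha}$ holomorphic on $\mathbf{D}_\alpha$, and the 1-cochain $F=\{F_{\mathbf{D}_\alpha\mathbf{D}_\beta}\}_{\alpha,\beta=0,1,\infty}$, with $F_{\mathbf{D}_\alpha\mathbf{D}_\beta}$ holomorphic on $\mathbf{D}_\alpha\cap\mathbf{D}_\beta$, defined for $j=0,2,4$ by $$f_{\mathbf{D}_{t_j^{-1}(0)}}(z)=f_j(z),\qquad F_{\mathbf{D}_{t_j^{-1}(0)}\mathbf{D}_{t_j^{-1}(1)}}(z)=\tfrac12\log^2 z_j-\log z_j\log z_{j+1}+\zeta(2),$$ together with $F_{\mathbf{D}_\beta\mathbf{D}_\alpha}=-F_{\mathbf{D}_\alpha\mathbf{D}_\beta}$. Then: (i) $F$ is a 1-cocycle, i.e. it satisfies the cocycle condition $$F_{\mathbf{D}_1\mathbf{D}_\infty}(z)-F_{\mathbf{D}_0\mathbf{D}_\infty}(z)+F_{\mathbf{D}_0\mathbf{D}_1}(z)=0\qquad (z\in\mathbf{D}_0\cap\mathbf{D}_1\cap\mathbf{D}_\infty).$$ (ii) The cocycle condition displayed in (i) is equivalent to the Euler formula $\zeta(2)=\frac{\pi^2}{6}$.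 (iii) The system consisting of, for all $j=0,2,4$, $$\text{(A)}\quad f_j(z)+\log z_j\log z_{j+1}+f_{j+1}(z)=\zeta(2)\quad (z\in\mathbf{D}_{t_j^{-1}(0)}\cap\mathbf{D}_{t_j^{-1}(1)}),$$ $$\text{(B)}\quad f_{j-1}(z)=-f_j(z)-\tfrac12\log^2 z_{j+1}\quad (z\in\mathbf{D}_{t_j^{-1}(0)})$$ is equivalent to the system consisting of (B) for all $j=0,2,4$ and the coboundary relations $$F_{\mathbf{D}_{t_j^{-1}(0)}\mathbf{D}_{t_j^{-1}(1)}}(z)=f_{\mathbf{D}_{t_j^{-1}(0)}}(z)-f_{\mathbf{D}_{t_j^{-1}(1)}}(z)\qquad (z\in\mathbf{D}_{t_j^{-1}(0)}\cap\mathbf{D}_{t_j^{-1}(1)})$$ for all $j=0,2,4$.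
   Context: Let $\mathbf{P}^1=\mathbf{C}\cup\{\infty\}$ be the Riemann sphere, with the open covering by $\mathbf{D}_0=\mathbf{C}\setminus[1,+\infty)$, $\mathbf{D}_1=\mathbf{C}\setminus(-\infty,0]$, $\mathbf{D}_\infty=\mathbf{P}^1\setminus[0,1]$. The triple intersection $\mathbf{D}_0\cap\mathbf{D}_1\cap\mathbf{D}_\infty$ is the union of the open upper and lower half planes. Define automorphisms $t_i$ of $\mathbf{P}^1$ and write $z_i=t_i(z)$: $z_0=z$, $z_1=1-z$, $z_2=\frac{z-1}{z}$, $z_3=\frac1z$, $z_4=\frac1{1-z}$, $z_5=\frac{z}{z-1}$; the index $i$ is taken modulo $6$. One has $t_0^{-1}(0)=0,\ t_0^{-1}(1)=1$; $t_2^{-1}(0)=1,\ t_2^{-1}(1)=\infty$; $t_4^{-1}(0)=\infty,\ t_4^{-1}(1)=0$. Thus $f_0,f_5$ are holomorphic in $\mathbf{D}_0$, $f_2,f_1$ in $\mathbf{D}_1$, $f_4,f_3$ in $\mathbf{D}_\infty$; the 0-cochain is $f_{\mathbf{D}_0}=f_0$, $f_{\mathbf{D}_1}=f_2$, $f_{\mathbf{D}_\infty}=f_4$; and the formula for $F$ with $j=0,2,4$ defines $F_{\mathbf{D}_0\mathbf{D}_1}$, $F_{\mathbf{D}_1\mathbf{D}_\infty}$, $F_{\mathbf{D}_\infty\mathbf{D}_0}$ respectively. $\log$ denotes the principal branch on $\mathbf{C}\setminus(-\infty,0]$ (with $\log 1=0$), and $\log^2 w=(\log w)^2$. $\zeta(2)=\sum_{n\ge1}n^{-2}$.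 The equations (A) and (B) together are called the hexagon equations for dilogarithms. *)

theory Defs
  imports "HOL-Analysis.Analysis"
begin

text \<open>
  The Riemann sphere is the type \<^typ>\<open>complex option\<close> underlying the one-point compactification
  \<^term>\<open>Alexandroff_compactification (euclidean :: complex topology)\<close>; \<^term>\<open>None\<close> is the point at
  infinity.
\<close>

type_synonym sphere = "complex option"

definition sphere_holomorphic_on :: "(sphere \<Rightarrow> complex) \<Rightarrow> sphere set \<Rightarrow> bool"
  (infix \<open>sphere'_holomorphic'_on\<close> 50) where
  \<comment> \<open>Used for open \<open>U\<close> only. The second conjunct is the chart at infinity, where
    the coordinate \<open>w = 1/z\<close> vanishes at infinity.\<close>
  "g sphere_holomorphic_on U \<longleftrightarrow>
     (\<lambda>z. g (Some z)) holomorphic_on {z. Some z \<in> U} \<and>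
     (\<lambda>w. g (if w = 0 then None else Some (1 / w)))
       holomorphic_on {w. (if w = 0 then None else Some (1 / w)) \<in> U}"

definition moebius :: "complex \<Rightarrow> complex \<Rightarrow> complex \<Rightarrow> complex \<Rightarrow> sphere \<Rightarrow> sphere" where
  "moebius a b c d p = (case p of
     None \<Rightarrow> if c = 0 then None else Some (a / c)
   | Some z \<Rightarrow> if c * z + d = 0 then None else Some ((a * z + b) / (c * z + d)))"

text \<open>Indices modulo 6 are elements of the ring \<^typ>\<open>6\<close> of integers modulo 6.\<close>

definition anharm :: "6 \<Rightarrow> sphere \<Rightarrow> sphere" where
  "anharm i =
     (if i = 0 then moebius 1 0 0 1
      else if i = 1 then moebius (-1) 1 0 1
      else if i = 2 then moebius 1 (-1) 1 0
      else if i = 3 then moebius 0 1 1 0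
      else if i = 4 then moebius 0 1 (-1) 1
      else moebius 1 0 1 (-1))"

definition vertices :: "sphere set" where
  "vertices = {Some 0, Some 1, None}"

definition cover :: "sphere \<Rightarrow> sphere set" where
  \<comment> \<open>The covering is indexed by the three points in \<open>vertices\<close>; the value elsewhere is irrelevant.\<close>
  "cover \<alpha> =
     (if \<alpha> = Some 0 then Some ` (UNIV - complex_of_real ` {1..})
      else if \<alpha> = Some 1 then Some ` (UNIV - complex_of_real ` {..0})
      else UNIV - Some ` complex_of_real ` {0..1})"

definition zeta2 :: real where
  "zeta2 = (\<Sum>n. 1 / real (Suc n) ^ 2)"

definition sphere_Log :: "sphere \<Rightarrow> complex" where
  \<comment> \<open>The value at infinity is never used: on the sets considered below all arguments are finite and
    lie off the cut (see \<open>anharm_slit\<close>).\<close>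
  "sphere_Log p = (case p of Some w \<Rightarrow> Ln w | None \<Rightarrow> 0)"

definition cochain0 :: "(sphere \<Rightarrow> sphere \<Rightarrow> complex) \<Rightarrow> bool" where
  "cochain0 f \<longleftrightarrow> (\<forall>\<alpha>\<in>vertices. f \<alpha> sphere_holomorphic_on cover \<alpha>)"

definition cochain1 :: "(sphere \<Rightarrow> sphere \<Rightarrow> sphere \<Rightarrow> complex) \<Rightarrow> bool" where
  "cochain1 F \<longleftrightarrow> (\<forall>\<alpha>\<in>vertices. \<forall>\<beta>\<in>vertices.
     F \<alpha> \<beta> sphere_holomorphic_on (cover \<alpha> \<inter> cover \<beta>) \<and>
     (\<forall>z \<in> cover \<alpha> \<inter> cover \<beta>. F \<beta> \<alpha> z = - F \<alpha> \<beta> z))"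

definition cocycle1 :: "(sphere \<Rightarrow> sphere \<Rightarrow> sphere \<Rightarrow> complex) \<Rightarrow> bool" where
  "cocycle1 F \<longleftrightarrow> cochain1 F \<and>
     (\<forall>\<alpha>\<in>vertices. \<forall>\<beta>\<in>vertices. \<forall>\<gamma>\<in>vertices. \<forall>z \<in> cover \<alpha> \<inter> cover \<beta> \<inter> cover \<gamma>.
        F \<beta> \<gamma> z - F \<alpha> \<gamma> z + F \<alpha> \<beta> z = 0)"

definition cocycle_condition :: "(sphere \<Rightarrow> sphere \<Rightarrow> sphere \<Rightarrow> complex) \<Rightarrow> bool" where
  "cocycle_condition F \<longleftrightarrow>
     (\<forall>z \<in> cover (Some 0) \<inter> cover (Some 1) \<inter> cover None.
        F (Some 1) None z - F (Some 0) None z + F (Some 0) (Some 1) z = 0)"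

text \<open>The 0-cochain \<open>f\<^sub>D\<close> attached to the family \<open>f\<close>; see \<open>dilog_cochain0_preimage\<close>.\<close>

definition dilog_cochain0 :: "(6 \<Rightarrow> sphere \<Rightarrow> complex) \<Rightarrow> sphere \<Rightarrow> sphere \<Rightarrow> complex" where
  "dilog_cochain0 f \<alpha> = (if \<alpha> = Some 0 then f 0 else if \<alpha> = Some 1 then f 2 else f 4)"

definition dilog_term :: "complex \<Rightarrow> 6 \<Rightarrow> sphere \<Rightarrow> complex" where
  "dilog_term c j z =
     1/2 * (sphere_Log (anharm j z))^2 - sphere_Log (anharm j z) * sphere_Log (anharm (j + 1) z) + c"

text \<open>
  The 1-cochain \<open>F\<close>; see \<open>dilog_cochain1_preimage\<close>. The constant \<open>c\<close> takes the place of
  the value \<open>\<zeta>(2)\<close>, so that the equivalence between the cocycle condition and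
  Euler's formula can be stated with content: both sides are true for \<open>c = \<zeta>(2)\<close>.
\<close>

definition dilog_cochain1 :: "complex \<Rightarrow> sphere \<Rightarrow> sphere \<Rightarrow> sphere \<Rightarrow> complex" where
  "dilog_cochain1 c \<alpha> \<beta> z =
     (if \<alpha> = Some 0 \<and> \<beta> = Some 1 then dilog_term c 0 z
      else if \<alpha> = Some 1 \<and> \<beta> = None then dilog_term c 2 z
      else if \<alpha> = None \<and> \<beta> = Some 0 then dilog_term c 4 z
      else if \<alpha> = Some 1 \<and> \<beta> = Some 0 then - dilog_term c 0 z
      else if \<alpha> = None \<and> \<beta> = Some 1 then - dilog_term c 2 z
      else if \<alpha> = Some 0 \<and> \<beta> = None then - dilog_term c 4 z
      else 0)"

lemma index6_distinct:
  "(1::6) \<noteq> 0" "(2::6) \<noteq> 0" "(3::6) \<noteq> 0" "(4::6) \<noteq> 0" "(5::6) \<noteq> 0"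
  "(2::6) \<noteq> 1" "(3::6) \<noteq> 1" "(4::6) \<noteq> 1" "(5::6) \<noteq> 1"
  "(3::6) \<noteq> 2" "(4::6) \<noteq> 2" "(5::6) \<noteq> 2"
  "(4::6) \<noteq> 3" "(5::6) \<noteq> 3" "(5::6) \<noteq> 4"
  "(0::6) - 1 = 5" "(2::6) - 1 = 1" "(4::6) - 1 = 3" "(5::6) + 1 = 0"
  by simp_all

lemma index6_cases: "i \<in> {0, 1, 2, 3, 4, 5}" for i :: 6
proof (cases i)
  case (of_int z)
  then have "z \<in> {0, 1, 2, 3, 4, 5}"
    by auto
  with of_int show ?thesis
    by auto
qed

lemma anharm_Some:
  "anharm 0 (Some z) = Some z"
  "anharm 1 (Some z) = Some (1 - z)"
  "anharm 2 (Some z) = (if z = 0 then None else Some ((z - 1) / z))"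
  "anharm 3 (Some z) = (if z = 0 then None else Some (1 / z))"
  "anharm 4 (Some z) = (if z = 1 then None else Some (1 / (1 - z)))"
  "anharm 5 (Some z) = (if z = 1 then None else Some (z / (z - 1)))"
  by (auto simp: anharm_def moebius_def)

lemma anharm_None:
  "anharm 0 None = None"
  "anharm 1 None = None"
  "anharm 2 None = Some 1"
  "anharm 3 None = Some 0"
  "anharm 4 None = Some 0"
  "anharm 5 None = Some 1"
  by (auto simp: anharm_def moebius_def)

lemma anharm_inverse:
  "anharm 0 (anharm 0 p) = p" "anharm 1 (anharm 1 p) = p" "anharm 2 (anharm 4 p) = p"
  "anharm 3 (anharm 3 p) = p" "anharm 4 (anharm 2 p) = p" "anharm 5 (anharm 5 p) = p"
  by (cases p; auto simp: anharm_Some anharm_None divide_simps)+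

lemma bij_anharm: "bij (anharm i)"
proof -
  have "\<exists>k. (\<forall>p. anharm i (anharm k p) = p) \<and> (\<forall>p. anharm k (anharm i p) = p)"
    using index6_cases[of i] anharm_inverse by blast
  then show ?thesis
    by (metis bijI')
qed

lemma anharm_preimage:
  "inv (anharm 0) (Some 0) = Some 0" "inv (anharm 0) (Some 1) = Some 1"
  "inv (anharm 2) (Some 0) = Some 1" "inv (anharm 2) (Some 1) = None"
  "inv (anharm 4) (Some 0) = None"   "inv (anharm 4) (Some 1) = Some 0"
  by (auto intro!: inv_f_eq bij_is_inj[OF bij_anharm] simp: anharm_Some anharm_None)

lemma openin_cover: "openin (Alexandroff_compactification euclidean) (cover \<alpha>)"
proof -
  have cl: "closed (complex_of_real ` S)" if "closed S" for S
    using that by (intro closed_injective_linear_image linear_of_real) (auto simp: linear_iff inj_def)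
  have "compact (complex_of_real ` {0..1})"
    by (intro compact_continuous_image continuous_intros) auto
  moreover have "UNIV - Some ` complex_of_real ` {0..1}
      = insert None (Some ` (UNIV - complex_of_real ` {0..1}))"
    (is "?L = ?R")
  proof (rule set_eqI)
    show "p \<in> ?L \<longleftrightarrow> p \<in> ?R" for p
      by (cases p) auto
  qed
  ultimately have "Alexandroff_open euclidean (UNIV - Some ` complex_of_real ` {0..1})"
    using Alexandroff_open.ext[of euclidean "complex_of_real ` {0..1}"] cl[of "{0..1}"] by simp
  moreover have "Alexandroff_open euclidean (Some ` (UNIV - complex_of_real ` S))"
    if "closed S" for S
    using cl[OF that] by (intro Alexandroff_open.base) (simp add: open_Diff)
  ultimately show ?thesis
    unfolding Alexandroff_compactification_def topology_inverse'[OF istopology_Alexandroff_open]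
    by (simp add: cover_def)
qed

lemma UN_cover: "(\<Union>\<alpha>\<in>vertices. cover \<alpha>) = UNIV"
proof -
  have "p \<in> cover (Some 0) \<union> cover (Some 1) \<union> cover None" for p
    by (cases p) (auto simp: cover_def image_iff)
  then show ?thesis
    by (auto simp: vertices_def)
qed

lemma dilog_cochain0_preimage:
  assumes "j \<in> {0, 2, 4}"
  shows "dilog_cochain0 f (inv (anharm j) (Some 0)) = f j"
  using assms by (auto simp: dilog_cochain0_def anharm_preimage)

lemma dilog_cochain1_preimage:
  assumes "j \<in> {0, 2, 4}"
  shows "dilog_cochain1 c (inv (anharm j) (Some 0)) (inv (anharm j) (Some 1)) z =
    1/2 * (sphere_Log (anharm j z))^2 - sphere_Log (anharm j z) * sphere_Log (anharm (j + 1) z) + c"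
  using assms by (auto simp: dilog_cochain1_def dilog_term_def anharm_preimage)

lemma dilog_cochain1_swap: "dilog_cochain1 c \<beta> \<alpha> z = - dilog_cochain1 c \<alpha> \<beta> z"
  by (auto simp: dilog_cochain1_def)

lemma anharm_slit:
  assumes "j \<in> {0, 2, 4}"
  shows "z \<in> cover (inv (anharm j) (Some 0)) \<Longrightarrow>
           \<exists>w. anharm (j + 1) z = Some w \<and> w \<notin> \<real>\<^sub>\<le>\<^sub>0"
    and "z \<in> cover (inv (anharm j) (Some 1)) \<Longrightarrow>
           \<exists>w. anharm j z = Some w \<and> w \<notin> \<real>\<^sub>\<le>\<^sub>0"
proof -
  have slit: "w \<notin> \<real>\<^sub>\<le>\<^sub>0" if "\<And>r. w = complex_of_real r \<Longrightarrow> r \<le> 0 \<Longrightarrow> False" for w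
    using that by (auto elim!: nonpos_Reals_cases)
  have no: "False" if "x \<notin> complex_of_real ` S" "x = complex_of_real r" "r \<in> S" for x r S
    using that by blast
  consider "j = 0" | "j = 2" | "j = 4"
    using assms by auto
  note cases = this
  {
    assume z: "z \<in> cover (inv (anharm j) (Some 0))"
    show "\<exists>w. anharm (j + 1) z = Some w \<and> w \<notin> \<real>\<^sub>\<le>\<^sub>0"
      using cases
    proof cases
      case 1
      then obtain x where x: "z = Some x" "x \<notin> complex_of_real ` {1..}"
        using z by (auto simp: anharm_preimage cover_def)
      have "1 - x \<notin> \<real>\<^sub>\<le>\<^sub>0"
        by (rule slit, rule no[OF x(2), of "1 - r" for r]) (auto simp: algebra_simps)
      then show ?thesis
        using 1 x by (simp add: anharm_Some)
    next
      case 2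
      then obtain x where x: "z = Some x" "x \<notin> complex_of_real ` {..0}"
        using z by (auto simp: anharm_preimage cover_def)
      have "1 / x \<notin> \<real>\<^sub>\<le>\<^sub>0"
      proof (rule slit)
        fix r :: real
        assume r: "1 / x = of_real r" "r \<le> 0"
        have "x = of_real (1 / r)"
          by (simp flip: r(1))
        with r(2) show False
          using no[OF x(2), of "1 / r"] by simp
      qed
      moreover have "x \<noteq> 0"
        using no[OF x(2), of 0] by auto
      ultimately show ?thesis
        using 2 x by (simp add: anharm_Some)
    next
      case 3
      show ?thesis
      proof (cases z)
        case None
        then show ?thesis
          using 3 by (simp add: anharm_None)
      next
        case (Some x)
        then have x: "x \<notin> complex_of_real ` {0..1}"
          using z 3 by (auto simp: anharm_preimage cover_def)
        have x1: "x \<noteq> 1"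
          using no[OF x, of 1] by auto
        have "x / (x - 1) \<notin> \<real>\<^sub>\<le>\<^sub>0"
        proof (rule slit)
          fix r :: real
          assume r: "x / (x - 1) = of_real r" "r \<le> 0"
          have "x / (x - 1) - 1 = 1 / (x - 1)"
            using x1 by (simp add: divide_simps)
          then have "x = of_real (r / (r - 1))"
            using x1 by (simp flip: r(1))
          moreover have "r / (r - 1) \<in> {0..1}"
            using r(2) by (simp add: divide_simps)
          ultimately show False
            using no[OF x] by blast
        qed
        then show ?thesis
          using 3 Some x1 by (simp add: anharm_Some)
      qed
    qed
  next
    assume z: "z \<in> cover (inv (anharm j) (Some 1))"
    show "\<exists>w. anharm j z = Some w \<and> w \<notin> \<real>\<^sub>\<le>\<^sub>0"
      using cases
    proof cases
      case 1
      then obtain x where x: "z = Some x" "x \<notin> complex_of_real ` {..0}"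
        using z by (auto simp: anharm_preimage cover_def)
      have "x \<notin> \<real>\<^sub>\<le>\<^sub>0"
        by (rule slit, rule no[OF x(2)]) auto
      then show ?thesis
        using 1 x by (simp add: anharm_Some)
    next
      case 2
      show ?thesis
      proof (cases z)
        case None
        then show ?thesis
          using 2 by (simp add: anharm_None)
      next
        case (Some x)
        then have x: "x \<notin> complex_of_real ` {0..1}"
          using z 2 by (auto simp: anharm_preimage cover_def)
        have x0: "x \<noteq> 0"
          using no[OF x, of 0] by auto
        have "(x - 1) / x \<notin> \<real>\<^sub>\<le>\<^sub>0"
        proof (rule slit)
          fix r :: real
          assume r: "(x - 1) / x = of_real r" "r \<le> 0"
          have "1 - (x - 1) / x = 1 / x"
            using x0 by (simp add: divide_simps)
          then have "x = of_real (1 / (1 - r))"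
            by (simp flip: r(1))
          moreover have "1 / (1 - r) \<in> {0..1}"
            using r(2) by (simp add: divide_simps)
          ultimately show False
            using no[OF x] by blast
        qed
        then show ?thesis
          using 2 Some x0 by (simp add: anharm_Some)
      qed
    next
      case 3
      then obtain x where x: "z = Some x" "x \<notin> complex_of_real ` {1..}"
        using z by (auto simp: anharm_preimage cover_def)
      have x1: "x \<noteq> 1"
        using no[OF x(2), of 1] by auto
      have "1 / (1 - x) \<notin> \<real>\<^sub>\<le>\<^sub>0"
      proof (rule slit)
        fix r :: real
        assume r: "1 / (1 - x) = of_real r" "r \<le> 0"
        have "x = of_real (1 - 1 / r)"
          by (simp flip: r(1))
        with r(2) show False
          using no[OF x(2), of "1 - 1 / r"] by simp
      qed
      then show ?thesis
        using 3 x x1 by (simp add: anharm_Some)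
    qed
  }
qed

end

theory Submission
  imports Defs
begin

text \<open>
  On the triple intersection write \<open>a\<close>, \<open>b\<close>, \<open>l\<close> for the logarithms of \<open>z\<^sub>0\<close>, \<open>z\<^sub>1\<close>, \<open>z\<^sub>2\<close>. Since
  \<open>z\<^sub>3\<close>, \<open>z\<^sub>4\<close>, \<open>z\<^sub>5\<close> are the inverses of \<open>z\<^sub>0\<close>, \<open>z\<^sub>1\<close>, \<open>z\<^sub>2\<close>, the cocycle sum collapses to
  \<open>(a - b + l)\<^sup>2 / 2 + 3 c\<close>. The exponential of \<open>a - b + l\<close> is \<open>-1\<close> and the imaginary
  parts of \<open>a\<close>, \<open>-b\<close>, \<open>l\<close> have the same sign and modulus less than \<open>\<pi>\<close>, so \<open>a - b + l = \<plusminus>\<i>\<pi>\<close>. Hence the sum is \<open>3 c - \<pi>\<^sup>2 / 2\<close>, which vanishes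
  exactly for \<open>c = \<pi>\<^sup>2 / 6\<close>. The same inversion of logarithms turns (A) into the coboundary relation
  once \<open>f\<^sub>j\<^sub>+\<^sub>1\<close> is eliminated by means of (B) for \<open>j + 2\<close>.
\<close>

section \<open>Euler's formula and logarithms on the half planes\<close>

lemma zeta2_eq: "zeta2 = pi\<^sup>2 / 6"
  using sums_unique[OF inverse_squares_sums] by (simp add: zeta2_def add.commute)

lemma Ln_inverse_off_cut: "Ln (1 / w) = - Ln w" if "w \<notin> \<real>\<^sub>\<le>\<^sub>0"
  using Ln_inverse[OF that] by (simp add: inverse_eq_divide)

lemma Ln_cross_ratio_upper:
  assumes "Im z > 0"
  shows "Ln z - Ln (1 - z) + Ln ((z - 1) / z) = \<i> * of_real pi"
proof -
  define s where "s = Ln z - Ln (1 - z) + Ln ((z - 1) / z)"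
  have nz: "z \<noteq> 0" "z \<noteq> 1"
    using assms by auto
  have "exp s = exp (\<i> * of_real pi)"
    unfolding s_def using nz by (simp add: exp_add exp_diff field_simps)
  then obtain n :: int where n: "s = \<i> * of_real pi + of_int (2 * n) * of_real pi * \<i>"
    unfolding exp_eq by (metis of_real_mult of_real_of_int_eq)
  have "Im ((z - 1) / z) = Im z / (norm z)\<^sup>2"
    by (simp add: Im_divide cmod_power2 algebra_simps diff_divide_distrib)
  then have "Im ((z - 1) / z) > 0"
    using assms nz by simp
  then have l: "0 < Im (Ln ((z - 1) / z))" "Im (Ln ((z - 1) / z)) < pi"
    using Im_Ln_pos_lt_imp by auto
  have a: "0 < Im (Ln z)" "Im (Ln z) < pi"
    using assms Im_Ln_pos_lt_imp by auto
  have b: "- pi < Im (Ln (1 - z))" "Im (Ln (1 - z)) < 0"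
    using mpi_less_Im_Ln[of "1 - z"] Im_Ln_pos_le[of "1 - z"] Im_Ln_le_pi[of "1 - z"] assms nz
    by auto
  \<comment> \<open>Each of the three summands contributes an imaginary part in (0, pi), and pi is
    the only odd multiple of pi between 0 and 3 pi.\<close>
  have "0 < Im s" "Im s < 3 * pi"
    using a b l by (auto simp: s_def)
  moreover have "Im s = pi * (1 + 2 * of_int n)"
    by (simp add: n algebra_simps)
  ultimately have "0 < 1 + 2 * real_of_int n" "1 + 2 * real_of_int n < 3"
    by (auto simp: zero_less_mult_iff)
  then have "n = 0"
    by linarith
  then show ?thesis
    using n by (simp add: s_def)
qed

text \<open>Conjugation carries the lower half plane to the upper one and commutes with
  \<open>Ln\<close> off the cut. It changes the sum from i pi to -i pi, a sign that squaring
  removes, so both components of the triple intersection give the same constant.\<close>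

lemma Ln_cross_ratio_square:
  assumes "z \<notin> \<real>"
  shows "(Ln z - Ln (1 - z) + Ln ((z - 1) / z))\<^sup>2 = - of_real (pi\<^sup>2)"
proof (cases "Im z > 0")
  case True
  then show ?thesis
    by (simp add: Ln_cross_ratio_upper power_mult_distrib)
next
  case False
  define u where "u = cnj z"
  have u: "Im u > 0" and z: "z = cnj u"
    using False assms by (auto simp: u_def complex_is_Real_iff)
  have "Im ((u - 1) / u) = Im u / (norm u)\<^sup>2"
    by (simp add: Im_divide cmod_power2 algebra_simps diff_divide_distrib)
  then have "Im ((u - 1) / u) > 0"
    using u by (auto simp: zero_less_divide_iff)
  then have "u \<notin> \<real>\<^sub>\<le>\<^sub>0" "1 - u \<notin> \<real>\<^sub>\<le>\<^sub>0" "(u - 1) / u \<notin> \<real>\<^sub>\<le>\<^sub>0"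
    using u unfolding complex_nonpos_Reals_iff by auto
  note this[THEN cnj_Ln]
  then have "Ln z - Ln (1 - z) + Ln ((z - 1) / z) = cnj (Ln u - Ln (1 - u) + Ln ((u - 1) / u))"
    unfolding z by simp
  then show ?thesis
    using Ln_cross_ratio_upper[OF u] by (simp add: power_mult_distrib)
qed

section \<open>The cocycle sum on the triple intersection\<close>

lemma index6_wrap: "(6 :: 6) = 0" "(7 :: 6) = 1"
  by simp_all

lemma anharm_preimage_shift:
  assumes "j \<in> {0, 2, 4}"
  shows "inv (anharm (j + 2)) (Some 0) = inv (anharm j) (Some 1)"
  using assms by (auto simp: anharm_preimage index6_wrap)

text \<open>Shifting the index by 3 inverts the coordinate, and on this piece of the covering
  \<open>anharm j z\<close> stays off the cut, where the logarithm of an inverse changes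
  sign.\<close>

lemma sphere_Log_anharm_shift3:
  assumes "j \<in> {0, 2, 4}" "z \<in> cover (inv (anharm j) (Some 1))"
  shows "sphere_Log (anharm (j + 3) z) = - sphere_Log (anharm j z)"
proof -
  obtain w where w: "anharm j z = Some w" "w \<notin> \<real>\<^sub>\<le>\<^sub>0"
    using anharm_slit(2)[OF assms] by auto
  have "anharm (j + 3) z = anharm 3 (anharm j z)"
    using assms(1) by (cases z) (auto simp: anharm_Some anharm_None index6_wrap)
  then show ?thesis
    using w Ln_inverse_off_cut[OF w(2)] by (auto simp: anharm_Some sphere_Log_def)
qed

lemma cover_triple_eq:
  "cover (Some 0) \<inter> cover (Some 1) \<inter> cover None = Some ` (- \<real>)"
proof -
  \<comment> \<open>The three cuts together exhaust the real line.\<close>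
  have "r \<ge> 1 \<or> r \<le> 0 \<or> 0 \<le> r \<and> r \<le> 1" for r :: real
    by linarith
  then show ?thesis
    by (fastforce simp: cover_def Reals_def image_iff)
qed

lemma dilog_term_sum:
  assumes "z \<in> cover (Some 0) \<inter> cover (Some 1) \<inter> cover None"
  shows "dilog_term c 0 z + dilog_term c 2 z + dilog_term c 4 z = 3 * c - of_real (pi\<^sup>2) / 2"
proof -
  define L where "L i = sphere_Log (anharm i z)" for i
  obtain w where w: "z = Some w" "w \<notin> \<real>"
    using assms unfolding cover_triple_eq by auto
  have "w \<noteq> 0"
    using w by auto
  then have L012: "L 0 = Ln w" "L 1 = Ln (1 - w)" "L 2 = Ln ((w - 1) / w)"
    by (auto simp: L_def w anharm_Some sphere_Log_def)
  have L345: "L 3 = - L 0" "L 4 = - L 1" "L 5 = - L 2"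
    using assms sphere_Log_anharm_shift3[of 0 z] sphere_Log_anharm_shift3[of 2 z]
      sphere_Log_anharm_shift3[of 4 z]
    by (simp_all add: L_def anharm_preimage index6_wrap)
  have "dilog_term c 0 z + dilog_term c 2 z + dilog_term c 4 z =
      1/2 * ((L 0)\<^sup>2 + (L 2)\<^sup>2 + (L 4)\<^sup>2) - (L 0 * L 1 + L 2 * L 3 + L 4 * L 5) + 3 * c"
    by (simp add: dilog_term_def L_def algebra_simps)
  also have "\<dots> = 1/2 * (L 0 - L 1 + L 2)\<^sup>2 + 3 * c"
    unfolding L345 by (simp add: power2_eq_square algebra_simps)
  finally show ?thesis
    using Ln_cross_ratio_square[OF w(2)] by (simp add: L012)
qed

lemma cocycle_condition_iff: "cocycle_condition (dilog_cochain1 c) \<longleftrightarrow> c = of_real (pi\<^sup>2 / 6)"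
proof -
  have "dilog_cochain1 c (Some 1) None z - dilog_cochain1 c (Some 0) None z
      + dilog_cochain1 c (Some 0) (Some 1) z = 0 \<longleftrightarrow> c = of_real (pi\<^sup>2 / 6)"
    if "z \<in> cover (Some 0) \<inter> cover (Some 1) \<inter> cover None" for z
  proof -
    have "dilog_cochain1 c (Some 1) None z - dilog_cochain1 c (Some 0) None z
      + dilog_cochain1 c (Some 0) (Some 1) z = 3 * c - of_real (pi\<^sup>2) / 2"
      using dilog_term_sum[OF that, of c] by (simp add: dilog_cochain1_def algebra_simps)
    moreover have "3 * c - of_real (pi\<^sup>2) / 2 = 0 \<longleftrightarrow> c = of_real (pi\<^sup>2 / 6)"
      by (auto simp: field_simps)
    ultimately show ?thesis
      by simp
  qed
  \<comment> \<open>A single point of the triple intersection lets the cocycle condition determine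
    \<open>c\<close>; over an empty set it would be vacuous.\<close>
  moreover have "Some \<i> \<in> cover (Some 0) \<inter> cover (Some 1) \<inter> cover None"
    unfolding cover_triple_eq by (simp add: complex_is_Real_iff)
  ultimately show ?thesis
    unfolding cocycle_condition_def by blast
qed

section \<open>Holomorphy of the 1-cochain\<close>

text \<open>Away from infinity the second chart is the first one composed with \<open>1 / w\<close>,
  since \<open>w = 0\<close> does not occur.\<close>

lemma sphere_holomorphic_on_finite_part:
  assumes "None \<notin> U" "(\<lambda>z. g (Some z)) holomorphic_on {z. Some z \<in> U}"
  shows "g sphere_holomorphic_on U"
proof -
  let ?V = "{w. (if w = 0 then None else Some (1 / w)) \<in> U}"
  have V: "w \<noteq> 0" "Some (1 / w) \<in> U" if "w \<in> ?V" for w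
    using that assms(1) by (auto split: if_splits)
  have "((\<lambda>z. g (Some z)) \<circ> (\<lambda>w. 1 / w)) holomorphic_on ?V"
  proof (rule holomorphic_on_compose_gen[OF _ assms(2)])
    show "(\<lambda>w. 1 / w) holomorphic_on ?V"
      using V(1) by (intro holomorphic_intros) blast
    show "(\<lambda>w. 1 / w) ` ?V \<subseteq> {z. Some z \<in> U}"
      using V(2) by blast
  qed
  then have "(\<lambda>w. g (if w = 0 then None else Some (1 / w))) holomorphic_on ?V"
  proof (rule holomorphic_transform)
    fix w
    assume "w \<in> ?V"
    then have "w \<noteq> 0"
      by (rule V(1))
    then show "((\<lambda>z. g (Some z)) \<circ> (\<lambda>w. 1 / w)) w = g (if w = 0 then None else Some (1 / w))"
      by simp
  qed
  then show ?thesis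
    using assms(2) by (simp add: sphere_holomorphic_on_def)
qed

lemma holomorphic_on_sphere_Log_anharm:
  assumes "\<And>z. z \<in> S \<Longrightarrow> \<exists>w. anharm i (Some z) = Some w \<and> w \<notin> \<real>\<^sub>\<le>\<^sub>0"
  shows "(\<lambda>z. sphere_Log (anharm i (Some z))) holomorphic_on S"
proof -
  define h where "h z = (if i = 0 then z else if i = 1 then 1 - z else if i = 2 then (z - 1) / z
    else if i = 3 then 1 / z else if i = 4 then 1 / (1 - z) else z / (z - 1))" for z :: complex
  have h: "anharm i (Some z) = Some (h z)" "h z \<notin> \<real>\<^sub>\<le>\<^sub>0" if "z \<in> S" for z
    using assms[OF that] index6_cases[of i]
    by (auto simp: h_def anharm_Some split: if_splits)
  \<comment> \<open>The points 0 and 1 are the finite poles of the maps; there \<open>anharm\<close>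
    takes the value \<open>None\<close>, which the assumption on \<open>S\<close> excludes.\<close>
  have "0 \<notin> S" if "i \<in> {2, 3}"
    using assms[of 0] that by (auto simp: anharm_Some)
  moreover have "1 \<notin> S" if "i \<in> {4, 5}"
    using assms[of 1] that by (auto simp: anharm_Some)
  ultimately have "h holomorphic_on S"
    using index6_cases[of i] unfolding h_def
    by (auto intro!: holomorphic_intros)
  then have "(\<lambda>z. Ln (h z)) holomorphic_on S"
    using h by (intro holomorphic_intros) auto
  then show ?thesis
    by (rule holomorphic_transform) (use h in \<open>auto simp: sphere_Log_def\<close>)
qed

lemma dilog_term_sphere_holomorphic:
  assumes "j \<in> {0, 2, 4}"
  shows "dilog_term c j sphere_holomorphic_on
    cover (inv (anharm j) (Some 0)) \<inter> cover (inv (anharm j) (Some 1))"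
proof (rule sphere_holomorphic_on_finite_part)
  let ?U = "cover (inv (anharm j) (Some 0)) \<inter> cover (inv (anharm j) (Some 1))"
  \<comment> \<open>Every pairwise intersection involves the piece at 0 or the piece at 1, and both
    omit infinity.\<close>
  show "None \<notin> ?U"
    using assms by (auto simp: anharm_preimage cover_def)
  have "(\<lambda>z. sphere_Log (anharm j (Some z))) holomorphic_on {z. Some z \<in> ?U}"
    "(\<lambda>z. sphere_Log (anharm (j + 1) (Some z))) holomorphic_on {z. Some z \<in> ?U}"
    using anharm_slit[OF assms] by (auto intro!: holomorphic_on_sphere_Log_anharm)
  then show "(\<lambda>z. dilog_term c j (Some z)) holomorphic_on {z. Some z \<in> ?U}"
    unfolding dilog_term_def by (intro holomorphic_intros)
qed

lemma sphere_holomorphic_on_uminus: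
  "g sphere_holomorphic_on U \<Longrightarrow> (\<lambda>z. - g z) sphere_holomorphic_on U"
  by (auto simp: sphere_holomorphic_on_def intro!: holomorphic_intros)

lemma sphere_holomorphic_on_zero: "(\<lambda>z. 0) sphere_holomorphic_on U"
  by (auto simp: sphere_holomorphic_on_def)

lemma cochain1_dilog_cochain1: "cochain1 (dilog_cochain1 c)"
proof -
  have T: "dilog_term c 0 sphere_holomorphic_on cover (Some 0) \<inter> cover (Some 1)"
    "dilog_term c 2 sphere_holomorphic_on cover (Some 1) \<inter> cover None"
    "dilog_term c 4 sphere_holomorphic_on cover None \<inter> cover (Some 0)"
    using dilog_term_sphere_holomorphic[of 0 c] dilog_term_sphere_holomorphic[of 2 c]
      dilog_term_sphere_holomorphic[of 4 c]
    by (simp_all add: anharm_preimage)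
  note T' = T[THEN sphere_holomorphic_on_uminus]
  have "dilog_cochain1 c \<alpha> \<beta> sphere_holomorphic_on cover \<alpha> \<inter> cover \<beta>"
    if "\<alpha> \<in> vertices" "\<beta> \<in> vertices" for \<alpha> \<beta>
    using that T T' sphere_holomorphic_on_zero
    by (auto simp: vertices_def dilog_cochain1_def[abs_def] Int_commute)
  then show ?thesis
    using dilog_cochain1_swap unfolding cochain1_def by blast
qed

section \<open>From one ordered triple of indices to all of them\<close>

lemma cocycle1_iff_cocycle_condition:
  "cocycle1 (dilog_cochain1 c) \<longleftrightarrow> cocycle_condition (dilog_cochain1 c)"
proof
  assume "cocycle1 (dilog_cochain1 c)"
  then show "cocycle_condition (dilog_cochain1 c)"
    by (auto simp: cocycle1_def cocycle_condition_def vertices_def)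
next
  assume *: "cocycle_condition (dilog_cochain1 c)"
  have S: "dilog_term c 0 z + dilog_term c 2 z + dilog_term c 4 z = 0"
    if "z \<in> cover (Some 0)" "z \<in> cover (Some 1)" "z \<in> cover None" for z
    using * that
    by (auto simp: cocycle_condition_def dilog_cochain1_def algebra_simps)
  have "dilog_cochain1 c \<beta> \<gamma> z - dilog_cochain1 c \<alpha> \<gamma> z + dilog_cochain1 c \<alpha> \<beta> z = 0"
    if "\<alpha> \<in> vertices" "\<beta> \<in> vertices" "\<gamma> \<in> vertices" "z \<in> cover \<alpha> \<inter> cover \<beta> \<inter> cover \<gamma>" for \<alpha> \<beta> \<gamma> z
  proof (cases "\<alpha> = \<beta> \<or> \<beta> = \<gamma> \<or> \<alpha> = \<gamma>")
    \<comment> \<open>With a repeated index the sum cancels by antisymmetry and the vanishing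
      diagonal.\<close>
    case True
    moreover have "dilog_cochain1 c \<alpha> \<alpha> z = 0" for \<alpha>
      by (auto simp: dilog_cochain1_def)
    ultimately show ?thesis
      using dilog_cochain1_swap[of c \<alpha> \<beta> z] by auto
  next
    case False
    then have "vertices \<subseteq> {\<alpha>, \<beta>, \<gamma>}"
      using that(1-3) by (auto simp: vertices_def)
    then have "z \<in> cover \<delta>" if "\<delta> \<in> vertices" for \<delta>
      using \<open>z \<in> cover \<alpha> \<inter> cover \<beta> \<inter> cover \<gamma>\<close> that by auto
    then have "z \<in> cover (Some 0)" "z \<in> cover (Some 1)" "z \<in> cover None"
      by (simp_all add: vertices_def)
    \<comment> \<open>For each of the six orderings the sum is, up to sign, the sum of the three
      terms; solving for one of them makes the relation a rewrite rule.\<close>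
    from S[OF this] have "dilog_term c 0 z = - dilog_term c 2 z - dilog_term c 4 z"
      by algebra
    with that(1-3) False show ?thesis
      unfolding vertices_def
      by (elim insertE emptyE) (simp_all add: dilog_cochain1_def)
  qed
  then show "cocycle1 (dilog_cochain1 c)"
    using cochain1_dilog_cochain1 by (auto simp: cocycle1_def)
qed

section \<open>Hexagon equations and coboundary relations\<close>

text \<open>Both systems in (iii) contain (B), so (A) and the coboundary relation may be compared
  pointwise. The premise offers (B) for all indices at once because the comparison at
  \<open>j\<close> uses it at \<open>j + 2\<close>.\<close>

lemma ball_conj_swap_cong:
  assumes "\<And>j z. \<lbrakk>j \<in> J; z \<in> P j \<inter> Q j; \<forall>j\<in>J. \<forall>z\<in>P j. B j z\<rbrakk> \<Longrightarrow> A j z \<longleftrightarrow> C j z"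
  shows "(\<forall>j\<in>J. (\<forall>z\<in>P j \<inter> Q j. A j z) \<and> (\<forall>z\<in>P j. B j z)) \<longleftrightarrow>
    (\<forall>j\<in>J. (\<forall>z\<in>P j. B j z) \<and> (\<forall>z\<in>P j \<inter> Q j. C j z))"
  using assms by blast

lemma dilog_relation_iff_coboundary:
  fixes f :: "6 \<Rightarrow> sphere \<Rightarrow> complex"
  assumes j: "j \<in> {0, 2, 4}"
    and z: "z \<in> cover (inv (anharm j) (Some 0)) \<inter> cover (inv (anharm j) (Some 1))"
    and B: "\<forall>j\<in>{0, 2, 4}. \<forall>z\<in>cover (inv (anharm j) (Some 0)).
      f (j - 1) z = - f j z - 1/2 * (sphere_Log (anharm (j + 1) z))\<^sup>2"
  shows "f j z + sphere_Log (anharm j z) * sphere_Log (anharm (j + 1) z) + f (j + 1) z = c \<longleftrightarrow>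
    dilog_cochain1 c (inv (anharm j) (Some 0)) (inv (anharm j) (Some 1)) z
      = dilog_cochain0 f (inv (anharm j) (Some 0)) z - dilog_cochain0 f (inv (anharm j) (Some 1)) z"
proof -
  have j2: "j + 2 \<in> {0, 2, 4}"
    using j by auto
  have eqs: "j + 2 - 1 = j + 1" "j + 2 + 1 = j + 3"
    by simp_all
  \<comment> \<open>This is (B) at index \<open>j + 2\<close>, available at \<open>z\<close> because
    the zero of t_{j+2} is the point that t_j sends to 1.\<close>
  have "f (j + 1) z = - f (j + 2) z - 1/2 * (sphere_Log (anharm (j + 3) z))\<^sup>2"
    using B[rule_format, OF j2, of z] z unfolding anharm_preimage_shift[OF j] eqs by blast
  then have f1: "f (j + 1) z = - f (j + 2) z - 1/2 * (sphere_Log (anharm j z))\<^sup>2"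
    using sphere_Log_anharm_shift3[OF j] z by simp
  have "dilog_cochain0 f (inv (anharm j) (Some 1)) = f (j + 2)"
    using dilog_cochain0_preimage[OF j2] by (simp add: anharm_preimage_shift[OF j])
  then show ?thesis
    unfolding dilog_cochain1_preimage[OF j] dilog_cochain0_preimage[OF j] f1
    by (auto simp: algebra_simps)
qed

theorem proposition3p1:
  fixes f :: "6 \<Rightarrow> sphere \<Rightarrow> complex"
  assumes "\<And>j. j \<in> {0, 2, 4} \<Longrightarrow>
      f j sphere_holomorphic_on cover (inv (anharm j) (Some 0)) \<and>
      f (j - 1) sphere_holomorphic_on cover (inv (anharm j) (Some 0))"
  shows
    "cochain0 (dilog_cochain0 f) \<and> cochain1 (dilog_cochain1 (of_real zeta2)) \<and>
     \<comment> \<open>(i)\<close>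
     cocycle1 (dilog_cochain1 (of_real zeta2)) \<and>
     cocycle_condition (dilog_cochain1 (of_real zeta2)) \<and>
     \<comment> \<open>(ii)\<close>
     (cocycle_condition (dilog_cochain1 (of_real zeta2)) \<longleftrightarrow> zeta2 = pi\<^sup>2 / 6) \<and>
     (\<forall>c. cocycle_condition (dilog_cochain1 c) \<longleftrightarrow> c = of_real (pi\<^sup>2 / 6)) \<and>
     \<comment> \<open>(iii)\<close>
     ((\<forall>j\<in>{0, 2, 4}.
         (\<forall>z \<in> cover (inv (anharm j) (Some 0)) \<inter> cover (inv (anharm j) (Some 1)).
            f j z + sphere_Log (anharm j z) * sphere_Log (anharm (j + 1) z) + f (j + 1) z
              = of_real zeta2) \<and>
         (\<forall>z \<in> cover (inv (anharm j) (Some 0)).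
            f (j - 1) z = - f j z - 1/2 * (sphere_Log (anharm (j + 1) z))\<^sup>2))
      \<longleftrightarrow>
      (\<forall>j\<in>{0, 2, 4}.
         (\<forall>z \<in> cover (inv (anharm j) (Some 0)).
            f (j - 1) z = - f j z - 1/2 * (sphere_Log (anharm (j + 1) z))\<^sup>2) \<and>
         (\<forall>z \<in> cover (inv (anharm j) (Some 0)) \<inter> cover (inv (anharm j) (Some 1)).
            dilog_cochain1 (of_real zeta2) (inv (anharm j) (Some 0)) (inv (anharm j) (Some 1)) z
              = dilog_cochain0 f (inv (anharm j) (Some 0)) z
                - dilog_cochain0 f (inv (anharm j) (Some 1)) z)))"
proof (intro conjI)
  show "cochain0 (dilog_cochain0 f)"
    using assms[of 0] assms[of 2] assms[of 4]
    by (auto simp: cochain0_def vertices_def dilog_cochain0_def anharm_preimage)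
  show "cochain1 (dilog_cochain1 (of_real zeta2))"
    by (rule cochain1_dilog_cochain1)
  show "cocycle1 (dilog_cochain1 (of_real zeta2))"
    by (simp add: cocycle1_iff_cocycle_condition cocycle_condition_iff zeta2_eq)
  show "cocycle_condition (dilog_cochain1 (of_real zeta2))"
    by (simp add: cocycle_condition_iff zeta2_eq)
  show "cocycle_condition (dilog_cochain1 (of_real zeta2)) \<longleftrightarrow> zeta2 = pi\<^sup>2 / 6"
    \<comment> \<open>The equivalence for arbitrary \<open>c\<close> is specialised here, without
      using the truth of either side.\<close>
    unfolding cocycle_condition_iff of_real_eq_iff ..
  show "\<forall>c. cocycle_condition (dilog_cochain1 c) \<longleftrightarrow> c = of_real (pi\<^sup>2 / 6)"
    using cocycle_condition_iff by blast
qed (rule ball_conj_swap_cong, rule dilog_relation_iff_coboundary)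

end
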